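(* Let $k$ be a positive integer and let $G$ be a $k$-connected $\Delta$-regular graph of order $n$. If $H$ is a proper subgraph of $G$, then $$\Delta-\lambda_{1}(H)>\frac{k^{2}}{(n-\Delta-1)(n-\Delta+2k-2)+nk^{2}}.$$
   Context: All graphs are finite and simple, with nonempty vertex set. The order of $G$ is its number of vertices. $\lambda_1(H)$ denotes the spectral radius of $H$, i.e. the largest eigenvalue of its adjacency matrix. A proper subgraph of $G$ is a subgraph (not necessarily spanning, induced or connected) different from $G$. A graph is $k$-connected in the usual (vertex-connectivity) sense: it has more than $k$ vertices and remains connected after removal of any fewer than $k$ vertices. *)

theory Defs
  imports "Graph_Theory.Digraph_Component" "Jordan_Normal_Form.Spectral_Radius"
begin

text \<open>
  Finite simple graphs are rendered by the locale \<^locale>\<open>pair_graph\<close>: the arc set is a finite,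
  symmetric, irreflexive relation on the finite vertex set, each undirected edge being the two arcs
  \<open>(u, v)\<close> and \<open>(v, u)\<close>. Hence the degree of a vertex is its \<^const>\<open>out_degree\<close>.
\<close>

definition regular_graph :: "nat \<Rightarrow> 'a pair_pre_digraph \<Rightarrow> bool" where
  "regular_graph d G \<longleftrightarrow> (\<forall>v \<in> pverts G. out_degree (with_proj G) v = d)"

definition k_connected_graph :: "nat \<Rightarrow> 'a pair_pre_digraph \<Rightarrow> bool" where
  "k_connected_graph k G \<longleftrightarrow>
     card (pverts G) > k \<and>
     (\<forall>S. S \<subseteq> pverts G \<and> card S < k \<longrightarrow>
        Digraph_Component.connected (induce_subgraph (with_proj G) (pverts G - S)))"

definition vertex_enum :: "'a pair_pre_digraph \<Rightarrow> 'a list" where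
  "vertex_enum G = (SOME vs. distinct vs \<and> set vs = pverts G)"

definition adjacency_matrix :: "'a pair_pre_digraph \<Rightarrow> real mat" where
  "adjacency_matrix G =
     (let vs = vertex_enum G in
      mat (length vs) (length vs) (\<lambda>(i, j). if (vs ! i, vs ! j) \<in> parcs G then 1 else 0))"

text \<open>
  The enumeration chosen in \<open>vertex_enum\<close> is immaterial: another one conjugates the matrix by a
  permutation matrix, which preserves the spectrum. On a graph with at least one vertex the
  maximum below is over a finite nonempty set, since the matrix is real symmetric. The library
  constant \<^const>\<open>spectral_radius\<close> is defined for complex matrices, as the largest modulus of an
  eigenvalue; here the spectral radius of a graph is the largest eigenvalue.
\<close>

definition lambda1 :: "'a pair_pre_digraph \<Rightarrow> real" where
  "lambda1 G = Max (spectrum (adjacency_matrix G))"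

end

theory Submission
  imports "HOL-Analysis.Lebesgue_Measure" Defs
begin

text \<open>
  Extend the absolute value of an eigenvector of \<open>H\<close> by zero to a function \<open>y\<close> on \<open>G\<close> with
  maximum \<open>1\<close>, attained at \<open>w\<close>. With \<open>\<delta> = \<Delta> - \<lambda>\<^sub>1(H)\<close> and \<open>L\<close> the Laplacian of \<open>G\<close>, it satisfies
  \<open>L y \<le> \<delta> y - r\<close> where, for an edge \<open>uv\<close> missing in \<open>H\<close>, \<open>r u \<ge> y v\<close> and \<open>r v \<ge> y u\<close>. Summing
  over all vertices bounds \<open>y u + y v\<close> by \<open>\<delta> n\<close>. With \<open>y u \<le> y v\<close>, it remains to bound the drop
  \<open>D = 1 - y u\<close> from \<open>w\<close> to \<open>u\<close>. The Dirichlet energy of \<open>f = max 0 (y - y u)\<close> is at most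
  \<open>\<delta> \<Sum> f\<close>. For the opposite estimate, \<open>k\<close>-connectivity enters without Menger's theorem, by a
  coarea argument: for each level \<open>t\<close> the vertices of \<open>{f > t}\<close> with a neighbour outside separate
  \<open>w\<close> from \<open>u\<close>, so at least \<open>k\<close> vertices \<open>z\<close> have \<open>t\<close> between \<open>f z\<close> and its least neighbouring
  value; at \<open>w\<close>, the \<open>k\<close> edges to its lowest neighbours are used instead, and only the \<open>k\<close>
  highest of the \<open>\<Delta>\<close> neighbours of \<open>u\<close> are needed. This leaves \<open>n - \<Delta> + 2k - 2\<close> drops; integrating
  over \<open>t\<close> and applying Cauchy--Schwarz to them gives the bound.
\<close>

unbundle no vec_syntax

section \<open>Auxiliary counting and integral inequalities\<close>

lemma exists_top_subset:
  fixes g :: "'a \<Rightarrow> 'b :: linorder"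
  assumes "finite A" "m \<le> card A"
  shows "\<exists>T\<subseteq>A. card T = m \<and> (\<forall>a\<in>T. \<forall>b\<in>A - T. g b \<le> g a)"
  using assms(2)
proof (induction m)
  case 0
  show ?case by (intro exI[of _ "{}"]) auto
next
  case (Suc m)
  then obtain T where T: "T \<subseteq> A" "card T = m" "\<forall>a\<in>T. \<forall>b\<in>A - T. g b \<le> g a"
    by auto
  have fin: "finite T" "finite (A - T)"
    using T(1) assms(1) finite_subset by auto
  have "A - T \<noteq> {}"
    using T(1,2) Suc.prems by auto
  then have "Max (g ` (A - T)) \<in> g ` (A - T)"
    using fin by (intro Max_in) auto
  then obtain c where c: "c \<in> A - T" "g c = Max (g ` (A - T))"
    by auto
  have "g b \<le> g c" if "b \<in> A - T" for b
    using that c fin by auto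
  then show ?case
    using T c fin by (intro exI[of _ "insert c T"]) auto
qed

text \<open>Integrate over \<open>t\<close> the number of half-open intervals containing
  \<open>t\<close>: each contributes its length, and the count is at least \<open>k\<close> below
  \<open>D\<close>. The two families stay apart because the same vertex may later index an interval
  in both.\<close>

lemma interval_cover_sum:
  fixes a b :: "'i \<Rightarrow> real" and c e :: "'j \<Rightarrow> real" and D :: real
  assumes fin: "finite I" "finite J" and "0 \<le> D"
    and cover: "\<And>t. 0 \<le> t \<Longrightarrow> t < D \<Longrightarrow>
      k \<le> card {i \<in> I. a i \<le> t \<and> t < b i} + card {j \<in> J. c j \<le> t \<and> t < e j}"
  shows "real k * D \<le> (\<Sum>i\<in>I. max 0 (b i - a i)) + (\<Sum>j\<in>J. max 0 (e j - c j))"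
proof -
  have int: "integrable lborel (indicator {p..<q} :: real \<Rightarrow> real)"
    "integral\<^sup>L lborel (indicator {p..<q}) = max 0 (q - p)" for p q :: real
    by (cases "p \<le> q"; simp add: integrable_indicator_iff)+
  have count: "(\<Sum>i\<in>X. indicator {p i..<q i} t) = real (card {i \<in> X. p i \<le> t \<and> t < q i})"
    if "finite X" for X :: "'x set" and p q :: "'x \<Rightarrow> real" and t
    using that by (simp add: indicator_def of_bool_def sum.If_cases Int_def)
  have "real k * D = (\<integral>t. real k * indicator {0..<D} t \<partial>lborel)"
    using \<open>0 \<le> D\<close> int by simp
  also have "\<dots> \<le> (\<integral>t. (\<Sum>i\<in>I. indicator {a i..<b i} t) + (\<Sum>j\<in>J. indicator {c j..<e j} t) \<partial>lborel)"
  proof (rule integral_mono)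
    show "real k * indicator {0..<D} t \<le>
        (\<Sum>i\<in>I. indicator {a i..<b i} t) + (\<Sum>j\<in>J. indicator {c j..<e j} t)" for t
      unfolding count[OF fin(1)] count[OF fin(2)]
      using cover[of t] by (simp add: indicator_def of_bool_def flip: of_nat_add)
  qed (use int in auto)
  also have "\<dots> = (\<Sum>i\<in>I. max 0 (b i - a i)) + (\<Sum>j\<in>J. max 0 (e j - c j))"
    using int(1) int(2)[simplified] by simp
  finally show ?thesis .
qed

text \<open>Cauchy--Schwarz in tangent form, from \<open>(a i - c)\<^sup>2 \<ge> 0\<close>. With a
  common \<open>c\<close>, such bounds over several index sets can simply be added.\<close>

lemma sum_squares_ge_tangent:
  fixes a :: "'i \<Rightarrow> real"
  shows "2 * c * (\<Sum>i\<in>I. a i) - c\<^sup>2 * real (card I) \<le> (\<Sum>i\<in>I. (a i)\<^sup>2)"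
proof -
  have "2 * c * (\<Sum>i\<in>I. a i) - c\<^sup>2 * real (card I) = (\<Sum>i\<in>I. 2 * c * a i - c\<^sup>2)"
    by (simp add: sum_subtractf sum_distrib_left)
  also have "\<dots> \<le> (\<Sum>i\<in>I. (a i)\<^sup>2)"
  proof (rule sum_mono)
    fix i
    have "0 \<le> (a i - c)\<^sup>2" by simp
    then show "2 * c * a i - c\<^sup>2 \<le> (a i)\<^sup>2"
      by (simp add: power2_diff algebra_simps)
  qed
  finally show ?thesis .
qed

section \<open>Regular k-connected graphs given by neighbourhoods\<close>

text \<open>\<open>edge_between\<close> expresses connectivity through cuts, without paths: the
  fewer than \<open>k\<close> vertices outside \<open>X\<close> and \<open>Y\<close> cannot separate
  \<open>X\<close> from \<open>Y\<close>.\<close>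

locale regular_k_connected =
  fixes V :: "'a set" and N :: "'a \<Rightarrow> 'a set" and k d :: nat
  assumes finite_V: "finite V"
    and N_subset: "a \<in> V \<Longrightarrow> N a \<subseteq> V"
    and N_sym: "b \<in> N a \<Longrightarrow> a \<in> N b"
    and N_irrefl: "a \<notin> N a"
    and card_N: "a \<in> V \<Longrightarrow> card (N a) = d"
    and k_pos: "0 < k"
    and k_less_card: "k < card V"
    and edge_between: "\<lbrakk>X \<subseteq> V; Y \<subseteq> V; X \<noteq> {}; Y \<noteq> {}; X \<inter> Y = {}; card (V - X - Y) < k\<rbrakk>
      \<Longrightarrow> \<exists>a\<in>X. \<exists>b\<in>Y. b \<in> N a"
begin

lemma N_in_V: "a \<in> V \<Longrightarrow> b \<in> N a \<Longrightarrow> b \<in> V"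
  using N_subset by blast

lemma finite_N: "a \<in> V \<Longrightarrow> finite (N a)"
  using N_subset finite_V finite_subset by blast

lemma d_less_card: "d < card V"
proof -
  obtain a where a: "a \<in> V"
    using k_less_card by fastforce
  have "N a \<subset> V"
    using N_subset[OF a] N_irrefl a by blast
  then show ?thesis
    using psubset_card_mono[OF finite_V] card_N[OF a] by auto
qed

text \<open>Otherwise the \<open>d\<close> neighbours of a vertex would be a cut of fewer than
  \<open>k\<close> vertices; a vertex to cut off exists because \<open>V\<close> has more than
  \<open>k \<ge> d + 1\<close> elements.\<close>

lemma k_le_d: "k \<le> d"
proof (rule ccontr)
  assume "\<not> k \<le> d"
  obtain a where a: "a \<in> V"
    using k_less_card by fastforce
  define Y where "Y = V - {a} - N a"
  have sep: "V - {a} - Y = N a"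
    using a N_subset N_irrefl unfolding Y_def by blast
  have "card (insert a (N a)) \<le> Suc d"
    using card_N[OF a] card_insert_le_m1 finite_N[OF a] by (simp add: N_irrefl)
  then have "insert a (N a) \<noteq> V"
    using \<open>\<not> k \<le> d\<close> k_less_card by auto
  then have "Y \<noteq> {}"
    using a N_subset unfolding Y_def by blast
  then obtain b where "b \<in> Y" "b \<in> N a"
    using edge_between[of "{a}" Y] sep a card_N[OF a] \<open>\<not> k \<le> d\<close> unfolding Y_def by auto
  then show False
    unfolding Y_def by auto
qed

text \<open>Swapping the ends of the edges symmetrises the left side, which is the Dirichlet energy.
  On the right each edge is charged to its higher end only, so lower bounds can be collected vertex
  by vertex.\<close>

lemma dirichlet_downhill:
  fixes f :: "'a \<Rightarrow> real"
  shows "(\<Sum>i\<in>V. f i * (\<Sum>j\<in>N i. f i - f j)) = (\<Sum>i\<in>V. \<Sum>j\<in>N i. (max 0 (f i - f j))\<^sup>2)"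
proof -
  define P where "P = Sigma V N"
  have swap: "(\<Sum>(i, j)\<in>P. g i j) = (\<Sum>(i, j)\<in>P. g j i)" for g :: "'a \<Rightarrow> 'a \<Rightarrow> real"
    unfolding P_def
    by (rule sum.reindex_bij_witness[of _ prod.swap prod.swap]) (auto intro: N_sym N_in_V)
  have S: "(\<Sum>i\<in>V. \<Sum>j\<in>N i. g i j) = (\<Sum>(i, j)\<in>P. g i j)" for g :: "'a \<Rightarrow> 'a \<Rightarrow> real"
    unfolding P_def using finite_V finite_N by (intro sum.Sigma) auto
  have pt: "x * (x - y) + y * (y - x) = (max 0 (x - y))\<^sup>2 + (max 0 (y - x))\<^sup>2" for x y :: real
    by (auto simp: max_def power2_eq_square algebra_simps)
  have "2 * (\<Sum>(i, j)\<in>P. f i * (f i - f j)) = (\<Sum>(i, j)\<in>P. f i * (f i - f j) + f j * (f j - f i))"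
    using swap[of "\<lambda>i j. f i * (f i - f j)"] by (simp add: sum.distrib split_def)
  also have "\<dots> = (\<Sum>(i, j)\<in>P. (max 0 (f i - f j))\<^sup>2 + (max 0 (f j - f i))\<^sup>2)"
    by (simp add: pt)
  also have "\<dots> = 2 * (\<Sum>(i, j)\<in>P. (max 0 (f i - f j))\<^sup>2)"
    using swap[of "\<lambda>i j. (max 0 (f i - f j))\<^sup>2"] by (simp add: sum.distrib split_def)
  finally have "(\<Sum>(i, j)\<in>P. f i * (f i - f j)) = (\<Sum>(i, j)\<in>P. (max 0 (f i - f j))\<^sup>2)"
    by linarith
  then show ?thesis
    unfolding S[symmetric] by (simp add: sum_distrib_left)
qed

lemma laplacian_sum:
  fixes f :: "'a \<Rightarrow> real"
  shows "(\<Sum>i\<in>V. \<Sum>j\<in>N i. f i - f j) = 0"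
proof -
  have "(\<Sum>(i, j)\<in>Sigma V N. f i - f j) = (\<Sum>(i, j)\<in>Sigma V N. f j - f i)"
    by (rule sum.reindex_bij_witness[of _ prod.swap prod.swap]) (auto intro: N_sym N_in_V)
  also have "\<dots> = - (\<Sum>(i, j)\<in>Sigma V N. f i - f j)"
    by (simp add: split_def flip: sum_negf)
  finally have "(\<Sum>(i, j)\<in>Sigma V N. f i - f j) = 0" by simp
  then show ?thesis
    using finite_V finite_N by (simp add: sum.Sigma)
qed

section \<open>Dirichlet energy against the drop of a potential\<close>

text \<open>The coarea argument bounds \<open>k * D\<close> by a sum of drops along edges,
  Cauchy--Schwarz bounds the sum of their squares from below, and \<open>source\<close> bounds the
  energy from above. The hypothesis \<open>c \<le> 2 * D\<close> keeps \<open>D - c / 2\<close>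
  nonnegative.\<close>

lemma potential_drop_bound:
  fixes f :: "'a \<Rightarrow> real" and c D :: real
  assumes u: "u \<in> V" "f u = 0" and w: "w \<in> V" "f w = D"
    and f: "\<And>z. z \<in> V \<Longrightarrow> 0 \<le> f z" "\<And>z. z \<in> V \<Longrightarrow> f z \<le> D"
    and c: "0 \<le> c" "c \<le> 2 * D" and D: "0 < D"
    and source: "(\<Sum>i\<in>V. f i * (\<Sum>j\<in>N i. f i - f j)) \<le> c * (\<Sum>i\<in>V. f i)"
  shows "(real k)\<^sup>2 * (D - c / 2)\<^sup>2 \<le>
    (real (card V) - real d + 2 * real k - 2) * (c * (real (card V) - real d - 1) * D + real d * c\<^sup>2 / 4)"
proof -
  define B where "B = V - {u, w} - N u"
  define m where "m z = Min (f ` N z)" for z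
  have Nne: "N z \<noteq> {}" if "z \<in> V" for z
    using card_N[OF that] k_le_d k_pos by auto
  have m_le: "m z \<le> f j" if "z \<in> V" "j \<in> N z" for z j
    unfolding m_def using finite_N[OF that(1)] that by auto
  have m_in: "\<exists>j\<in>N z. f j = m z" if "z \<in> V" for z
  proof -
    have "m z \<in> f ` N z"
      unfolding m_def using finite_N[OF that] Nne[OF that] by (intro Min_in) auto
    then show ?thesis by auto
  qed
  have m_nonneg: "0 \<le> m z" if "z \<in> V" for z
    using m_in[OF that] f N_subset[OF that] by force
  have m_nbr: "m z = 0" if "z \<in> N u" for z
    using m_le[of z u] m_nonneg[of z] that N_sym u N_subset by fastforce
  have uw: "u \<noteq> w" using u w D by auto
  obtain T where T: "T \<subseteq> N u" "card T = k" "\<forall>a\<in>T. \<forall>b\<in>N u - T. f b \<le> f a"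
    using exists_top_subset[of "N u" k f] finite_N[OF u(1)] card_N[OF u(1)] k_le_d by auto
  \<comment> \<open>The value at \<open>u\<close> is lowered so that, despite possible ties, \<open>u\<close> is chosen if adjacent to \<open>w\<close>.\<close>
  define g where "g z = (if z = u then 1 else - f z)" for z
  obtain K where K: "K \<subseteq> N w" "card K = k" "\<forall>a\<in>K. \<forall>b\<in>N w - K. g b \<le> g a"
    using exists_top_subset[of "N w" k g] finite_N[OF w(1)] card_N[OF w(1)] k_le_d by auto
  have KV: "K \<subseteq> V" using K N_subset w by blast
  have TV: "T \<subseteq> V" using T N_subset u by blast
  have fin: "finite K" "finite T" "finite B"
    using KV TV finite_V finite_subset unfolding B_def by auto
  have Kne: "K \<noteq> {}" using K k_pos by auto
  have Kbot: "f a \<le> f b" if "a \<in> K" "b \<in> N w - K" for a b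
    using K(3) that f(1)[of b] N_subset[OF w(1)] u unfolding g_def by (force split: if_splits)
  have uK: "u \<in> K" if "u \<in> N w"
  proof (rule ccontr)
    assume "u \<notin> K"
    moreover obtain a where "a \<in> K" using Kne by auto
    ultimately have "g u \<le> g a" "a \<noteq> u" using K(3) that by auto
    then show False
      using f(1)[of a] \<open>a \<in> K\<close> KV unfolding g_def by auto
  qed
  have disj: "T \<inter> B = {}" using T unfolding B_def by auto

  \<comment> \<open>If \<open>u\<close> and \<open>w\<close> are adjacent, the edge between them is
    counted at \<open>w\<close> as a neighbour of \<open>u\<close>; hence \<open>u\<close> is
    removed from \<open>K\<close>.\<close>
  have cover: "k \<le> card {z \<in> T \<union> B. m z \<le> t \<and> t < f z} + card {j \<in> K - {u}. f j \<le> t \<and> t < D}"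
    if t: "0 \<le> t" "t < D" for t
  proof -
    define U where "U = {z \<in> V. t < f z}"
    \<comment> \<open>The inner boundary of the superlevel set: without it, the rest of
      \<open>U\<close> is cut off from \<open>V - U\<close>.\<close>
    define S where "S = {z \<in> U. \<not> N z \<subseteq> U}"
    define C1 where "C1 = {z \<in> T \<union> B. m z \<le> t \<and> t < f z}"
    define C2 where "C2 = {j \<in> K - {u}. f j \<le> t \<and> t < D}"
    have wU: "w \<in> U" and uU: "u \<notin> U" using w u t unfolding U_def by auto
    have UV: "U \<subseteq> V" and SU: "S \<subseteq> U" unfolding U_def S_def by auto
    have finU: "finite U" "finite S" using UV SU finite_V finite_subset by (blast, meson finite_subset)
    have finC: "finite C1" "finite C2" using fin unfolding C1_def C2_def by auto
    have TC: "T \<inter> U \<subseteq> C1"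
      using m_nbr T t unfolding C1_def U_def by auto
    have "k \<le> card C1 + card C2"
    proof (cases "T \<subseteq> U")
      case True
      then have "k \<le> card C1" using TC T finC by (metis card_mono inf.absorb1)
      then show ?thesis by simp
    next
      case False
      then obtain a where a: "a \<in> T" "f a \<le> t" using TV unfolding U_def by force
      \<comment> \<open>One of the highest neighbours of \<open>u\<close>, collected in
        \<open>T\<close>, is not above \<open>t\<close>, so no neighbour outside \<open>T\<close>
        is. Boundary vertices other than \<open>w\<close> therefore lie in
        \<open>T \<union> B\<close>.\<close>
      have NuU: "N u \<inter> U \<subseteq> T"
      proof
        fix z assume z: "z \<in> N u \<inter> U"
        show "z \<in> T"
        proof (rule ccontr)
          assume "z \<notin> T"
          then have "f z \<le> f a" using T(3) a z by auto
          then show False using z a unfolding U_def by auto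
        qed
      qed
      have SC: "S - {w} \<subseteq> C1"
      proof
        fix z assume z: "z \<in> S - {w}"
        then obtain j where j: "j \<in> N z" "j \<notin> U" unfolding S_def by auto
        have zV: "z \<in> V" "t < f z" using z SU UV unfolding U_def by auto
        have "j \<in> V" using j zV N_subset by blast
        then have "f j \<le> t" using j unfolding U_def by auto
        then have "m z \<le> t" using m_le[OF zV(1) j(1)] by auto
        moreover have "z \<in> T \<union> B"
          using NuU z SU UV uU unfolding B_def by auto
        ultimately show "z \<in> C1" using zV unfolding C1_def by auto
      qed
      have wC: "w \<in> C1" if "u \<in> N w"
        using NuU wU N_sym[OF that] TC by auto
      have KC: "K - U - {u} \<subseteq> C2"
        using KV t unfolding C2_def U_def by force
      \<comment> \<open>If \<open>u\<close> and \<open>w\<close> are adjacent, the loss of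
        \<open>u\<close> from \<open>K - U\<close> is made up by \<open>w\<close>, which then
        belongs to \<open>C1\<close>.\<close>
      have key: "card (S - {w}) + card (K - U) \<le> card C1 + card C2"
      proof (cases "u \<in> N w")
        case True
        have "card (insert w (S - {w})) \<le> card C1"
          using SC wC[OF True] finC by (intro card_mono) auto
        then have 1: "Suc (card (S - {w})) \<le> card C1"
          using finU by (simp add: card.insert_remove)
        have "card (K - U) = Suc (card (K - U - {u}))"
          using uK[OF True] uU fin by (intro card.remove) auto
        also have "\<dots> \<le> Suc (card C2)" using KC finC card_mono by auto
        finally show ?thesis using 1 by simp
      next
        case False
        then have "K - U - {u} = K - U" using K by auto
        then show ?thesis using SC KC finC by (metis add_mono card_mono)
      qed
      have "k \<le> card (S - {w}) + card (K - U)"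
      proof (cases "k \<le> card S")
        case True
        show ?thesis
        proof (cases "w \<in> S")
          case True
          then obtain j where j: "j \<in> N w" "j \<notin> U" unfolding S_def by auto
          \<comment> \<open>As \<open>K\<close> holds lowest neighbours of \<open>w\<close>, it
            leaves \<open>U\<close> as soon as \<open>N w\<close> does. This makes up for dropping
            \<open>w\<close> from \<open>S\<close>.\<close>
          have "K - U \<noteq> {}"
          proof
            assume KU: "K - U = {}"
            obtain b where b: "b \<in> K" using Kne by auto
            have "f b \<le> f j" using Kbot[OF b] j KU by auto
            moreover have "j \<in> V" using j N_subset w by auto
            moreover have "t < f b" using b KU unfolding U_def by auto
            ultimately show False using j unfolding U_def by auto
          qed
          then have "0 < card (K - U)" using fin by (simp add: card_gt_0_iff)
          moreover have "card S = Suc (card (S - {w}))"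
            using True finU by (intro card.remove) auto
          ultimately show ?thesis using \<open>k \<le> card S\<close> by linarith
        next
          case False
          then show ?thesis using \<open>k \<le> card S\<close> by simp
        qed
      next
        case False
        \<comment> \<open>With fewer than \<open>k\<close> vertices, \<open>S\<close> cannot
          separate \<open>U - S\<close> from \<open>V - U\<close>, which contains \<open>u\<close>.
          No edge joins these two sets, so \<open>U - S\<close> is empty.\<close>
        have "U = S"
        proof (rule ccontr)
          assume "U \<noteq> S"
          have "V - (U - S) - (V - U) = S" using UV SU by auto
          then obtain a b where "a \<in> U - S" "b \<in> V - U" "b \<in> N a"
            using edge_between[of "U - S" "V - U"] \<open>U \<noteq> S\<close> False SU UV u uU
            by (metis Diff_disjoint Diff_eq_empty_iff Diff_subset Int_Diff Int_commute
                  inf.absorb_iff2 not_le subset_antisym subset_trans emptyE DiffI)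
          then show False unfolding S_def by auto
        qed
        \<comment> \<open>Here the degree of \<open>w\<close> supplies \<open>k\<close>: once a
          member of \<open>K\<close> is above \<open>t\<close>, so is all of \<open>N w - K\<close>,
          and every neighbour of \<open>w\<close> lies in \<open>U\<close> or in
          \<open>K - U\<close>.\<close>
        have "k \<le> card (U - {w}) + card (K - U)"
        proof (cases "K \<inter> U = {}")
          case True
          then have "K - U = K" by auto
          then show ?thesis using K by simp
        next
          case False
          then obtain b where b: "b \<in> K" "t < f b" unfolding U_def by auto
          have "N w \<subseteq> (U - {w}) \<union> (K - U)"
          proof
            fix z assume z: "z \<in> N w"
            then have "z \<noteq> w" "z \<in> V" using N_irrefl N_subset w by auto
            then show "z \<in> (U - {w}) \<union> (K - U)"
              using Kbot[OF b(1), of z] b z unfolding U_def by force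
          qed
          then have "card (N w) \<le> card ((U - {w}) \<union> (K - U))"
            using finU fin by (intro card_mono) auto
          also have "\<dots> \<le> card (U - {w}) + card (K - U)" by (rule card_Un_le)
          finally show ?thesis using card_N[OF w(1)] k_le_d by simp
        qed
        then show ?thesis using \<open>U = S\<close> by simp
      qed
      then show ?thesis using key by simp
    qed
    then show ?thesis unfolding C1_def C2_def .
  qed

  define dr where "dr z = max 0 (f z - m z)" for z
  have "real k * D \<le> (\<Sum>z\<in>T \<union> B. dr z) + (\<Sum>j\<in>K - {u}. max 0 (D - f j))"
    unfolding dr_def using fin D cover by (intro interval_cover_sum) auto
  also have "(\<Sum>j\<in>K - {u}. max 0 (D - f j)) = (\<Sum>j\<in>K - {u}. D - f j)"
    using f(2) KV by (intro sum.cong) auto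
  also have "(\<Sum>z\<in>T \<union> B. dr z) = (\<Sum>z\<in>T. dr z) + (\<Sum>z\<in>B. dr z)"
    using fin disj by (intro sum.union_disjoint) auto
  also have "(\<Sum>z\<in>T. dr z) = (\<Sum>z\<in>T. f z)"
    using m_nbr T(1) TV f(1) unfolding dr_def by (intro sum.cong refl) (simp add: subset_iff)
  finally have drops: "real k * D \<le> (\<Sum>z\<in>T. f z) + (\<Sum>z\<in>B. dr z) + (\<Sum>j\<in>K - {u}. D - f j)" .

  have V_split: "V = insert u (N u \<union> (V - {u} - N u))"
    using u N_subset by auto
  have cardV: "card V = Suc (d + card (V - {u} - N u))"
    using V_split card_N[OF u(1)] finite_N[OF u(1)] finite_V N_irrefl
    by (metis (no_types, lifting) Diff_disjoint Diff_iff Un_iff card.insert card_Un_disjoint finite_Diff finite_UnI insertI1)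
  \<comment> \<open>Only the vertices other than \<open>u\<close> and its neighbours are estimated
    by \<open>D\<close>; the sum over \<open>N u\<close> stays exact, to be absorbed by the squares
    there.\<close>
  have sum_f: "(\<Sum>i\<in>V. f i) \<le> (\<Sum>z\<in>N u. f z) + (real (card V) - real d - 1) * D"
  proof -
    have "(\<Sum>i\<in>V. f i) = f u + (\<Sum>z\<in>V - {u}. f z)"
      using finite_V u(1) by (simp add: sum.remove)
    also have "(\<Sum>z\<in>V - {u}. f z) = (\<Sum>z\<in>V - {u} - N u. f z) + (\<Sum>z\<in>N u. f z)"
      using N_subset[OF u(1)] N_irrefl finite_V by (intro sum.subset_diff) auto
    also have "(\<Sum>z\<in>V - {u} - N u. f z) \<le> real (card (V - {u} - N u)) * D"
      using f(2) by (intro sum_bounded_above) auto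
    finally show ?thesis using u cardV by simp
  qed

  have energy: "(\<Sum>z\<in>N u. (f z)\<^sup>2) + (\<Sum>z\<in>B. (dr z)\<^sup>2) + (\<Sum>j\<in>K - {u}. (D - f j)\<^sup>2)
      \<le> (\<Sum>i\<in>V. \<Sum>j\<in>N i. (max 0 (f i - f j))\<^sup>2)"
  proof -
    \<comment> \<open>The share of the energy charged to \<open>i\<close>. If \<open>w\<close> is
      adjacent to \<open>u\<close>, it is charged twice, for disjoint sets of edges: the one to
      \<open>u\<close> and those to \<open>K - {u}\<close>.\<close>
    define lo where "lo i = (if i \<in> N u then (f i)\<^sup>2 else 0) + (if i \<in> B then (dr i)\<^sup>2 else 0)
        + (if i = w then \<Sum>j\<in>K - {u}. (D - f j)\<^sup>2 else 0)" for i
    have "lo i \<le> (\<Sum>j\<in>N i. (max 0 (f i - f j))\<^sup>2)" if i: "i \<in> V" for i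
    proof -
      have one: "(max 0 (f i - f j))\<^sup>2 \<le> (\<Sum>j\<in>N i. (max 0 (f i - f j))\<^sup>2)" if "j \<in> N i" for j
        using finite_N[OF i] that by (intro member_le_sum) auto
      show ?thesis
      proof (cases "i = w")
        case True
        have "(\<Sum>j\<in>(K - {u}) \<union> (N w \<inter> {u}). (max 0 (f w - f j))\<^sup>2)
            \<le> (\<Sum>j\<in>N w. (max 0 (f w - f j))\<^sup>2)"
          using K finite_N[OF w(1)] by (intro sum_mono2) auto
        moreover have "(\<Sum>j\<in>(K - {u}) \<union> (N w \<inter> {u}). (max 0 (f w - f j))\<^sup>2)
            = (\<Sum>j\<in>K - {u}. (max 0 (f w - f j))\<^sup>2) + (\<Sum>j\<in>N w \<inter> {u}. (max 0 (f w - f j))\<^sup>2)"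
          using fin finite_N[OF w(1)] by (intro sum.union_disjoint) auto
        moreover have "(\<Sum>j\<in>K - {u}. (max 0 (f w - f j))\<^sup>2) = (\<Sum>j\<in>K - {u}. (D - f j)\<^sup>2)"
          using f(2) KV w by (intro sum.cong) auto
        moreover have "(\<Sum>j\<in>N w \<inter> {u}. (max 0 (f w - f j))\<^sup>2) = (if w \<in> N u then (f w)\<^sup>2 else 0)"
          using N_sym u w D by auto
        moreover have "w \<notin> B" unfolding B_def by auto
        ultimately show ?thesis unfolding lo_def True by simp
      next
        case False
        show ?thesis
        proof (cases "i \<in> N u")
          case True
          then have "i \<notin> B" unfolding B_def by auto
          then show ?thesis
            using one[OF N_sym[OF True]] False True u f(1)[OF i] unfolding lo_def by simp
        next
          case nbr: False
          obtain j where "j \<in> N i" "f j = m i" using m_in[OF i] by auto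
          then have "(dr i)\<^sup>2 \<le> (\<Sum>j\<in>N i. (max 0 (f i - f j))\<^sup>2)"
            using one[of j] unfolding dr_def by simp
          moreover have "0 \<le> (\<Sum>j\<in>N i. (max 0 (f i - f j))\<^sup>2)" by (intro sum_nonneg) auto
          ultimately show ?thesis using False nbr unfolding lo_def by simp
        qed
      qed
    qed
    then have "(\<Sum>i\<in>V. lo i) \<le> (\<Sum>i\<in>V. \<Sum>j\<in>N i. (max 0 (f i - f j))\<^sup>2)"
      by (rule sum_mono)
    moreover have "V \<inter> N u = N u" "V \<inter> B = B"
      using N_subset[OF u(1)] unfolding B_def by auto
    then have "(\<Sum>i\<in>V. lo i) = (\<Sum>z\<in>N u. (f z)\<^sup>2) + (\<Sum>z\<in>B. (dr z)\<^sup>2) + (\<Sum>j\<in>K - {u}. (D - f j)\<^sup>2)"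
      unfolding lo_def using finite_V w(1) by (simp add: sum.distrib flip: sum.inter_restrict)
    ultimately show ?thesis by simp
  qed

  \<comment> \<open>Completing the square at the neighbours of \<open>u\<close> absorbs their sources up to \<open>c\<^sup>2 / 4\<close> each.\<close>
  have square: "(\<Sum>z\<in>T. (f z - c / 2)\<^sup>2) + (\<Sum>z\<in>B. (dr z)\<^sup>2) + (\<Sum>j\<in>K - {u}. (D - f j)\<^sup>2)
      \<le> c * (real (card V) - real d - 1) * D + real d * c\<^sup>2 / 4"
  proof -
    have "(\<Sum>z\<in>T. (f z - c / 2)\<^sup>2) \<le> (\<Sum>z\<in>N u. (f z - c / 2)\<^sup>2)"
      using T finite_N[OF u(1)] by (intro sum_mono2) auto
    also have "\<dots> = (\<Sum>z\<in>N u. (f z)\<^sup>2 - c * f z + c\<^sup>2 / 4)"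
      by (intro sum.cong) (auto simp: power2_diff power_divide algebra_simps)
    also have "\<dots> = (\<Sum>z\<in>N u. (f z)\<^sup>2) - c * (\<Sum>z\<in>N u. f z) + real d * c\<^sup>2 / 4"
      by (simp add: sum.distrib sum_subtractf sum_distrib_left card_N[OF u(1)])
    finally have 1: "(\<Sum>z\<in>T. (f z - c / 2)\<^sup>2) \<le>
        (\<Sum>z\<in>N u. (f z)\<^sup>2) - c * (\<Sum>z\<in>N u. f z) + real d * c\<^sup>2 / 4" .
    have "c * (\<Sum>i\<in>V. f i) \<le> c * ((\<Sum>z\<in>N u. f z) + (real (card V) - real d - 1) * D)"
      using sum_f c by (intro mult_left_mono) auto
    then show ?thesis
      using 1 energy source unfolding dirichlet_downhill by (simp add: algebra_simps)
  qed

  define L where "L = real (card V) - real d + 2 * real k - 2"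
  have L_pos: "0 < L"
    using d_less_card k_pos unfolding L_def by linarith
  \<comment> \<open>From \<open>k + (card V - d - 1) + k\<close> exactly one is lost:
    \<open>u\<close> from \<open>K\<close> if it is adjacent to \<open>w\<close>, and otherwise
    \<open>w\<close> from the vertices not adjacent to \<open>u\<close>.\<close>
  have terms: "real (card T) + real (card B) + real (card (K - {u})) = L"
  proof (cases "u \<in> N w")
    case True
    then have "B = V - {u} - N u" using N_sym unfolding B_def by auto
    moreover have "card (K - {u}) = k - 1" using uK[OF True] K fin by simp
    ultimately show ?thesis using T cardV k_pos unfolding L_def by (simp add: of_nat_diff)
  next
    case False
    then have wB: "w \<in> V - {u} - N u" and "K - {u} = K" using N_sym w uw K by auto
    moreover have "B = (V - {u} - N u) - {w}" unfolding B_def by auto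
    ultimately have "card (V - {u} - N u) = Suc (card B)"
      using finite_V by (metis card.remove finite_Diff)
    then show ?thesis using T K cardV \<open>K - {u} = K\<close> unfolding L_def by simp
  qed

  define P where "P = D - c / 2"
  \<comment> \<open>The maximiser of \<open>2 * q * (real k * P) - q\<^sup>2 * L\<close>, with value
    \<open>(real k)\<^sup>2 * P\<^sup>2 / L\<close>.\<close>
  define q where "q = real k * P / L"
  have P0: "0 \<le> P" using c unfolding P_def by simp
  have q0: "0 \<le> q" using P0 L_pos unfolding q_def by simp
  have "(\<Sum>z\<in>T. f z - c / 2) = (\<Sum>z\<in>T. f z) - real k * c / 2"
    using T by (simp add: sum_subtractf)
  then have "real k * P \<le> (\<Sum>z\<in>T. f z - c / 2) + (\<Sum>z\<in>B. dr z) + (\<Sum>j\<in>K - {u}. D - f j)"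
    using drops unfolding P_def by (simp add: algebra_simps)
  then have "2 * q * (real k * P) - q\<^sup>2 * L \<le>
      2 * q * ((\<Sum>z\<in>T. f z - c / 2) + (\<Sum>z\<in>B. dr z) + (\<Sum>j\<in>K - {u}. D - f j)) - q\<^sup>2 * L"
    using q0 by (simp add: mult_left_mono)
  also have "\<dots> \<le> (\<Sum>z\<in>T. (f z - c / 2)\<^sup>2) + (\<Sum>z\<in>B. (dr z)\<^sup>2) + (\<Sum>j\<in>K - {u}. (D - f j)\<^sup>2)"
    using sum_squares_ge_tangent[of q "\<lambda>z. f z - c / 2" T] sum_squares_ge_tangent[of q dr B]
      sum_squares_ge_tangent[of q "\<lambda>j. D - f j" "K - {u}"]
    unfolding terms[symmetric] by (simp add: algebra_simps)
  also note square
  also have "2 * q * (real k * P) - q\<^sup>2 * L = (real k)\<^sup>2 * P\<^sup>2 / L"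
    using L_pos unfolding q_def by (simp add: field_simps power2_eq_square)
  finally show ?thesis
    using L_pos unfolding P_def L_def by (simp add: field_simps)
qed

section \<open>The gap for a subeigenvector\<close>

text \<open>If \<open>\<delta>\<close> were at most the bound, summing \<open>lap\<close> would make
  \<open>y u\<close> small and the drop \<open>1 - y u\<close> too large for
  \<open>potential_drop_bound\<close>. Here \<open>r\<close> stands for the contribution of deleted
  edges.\<close>

lemma eigenvalue_gap:
  fixes y :: "'a \<Rightarrow> real" and \<delta> :: real
  assumes y: "\<And>z. z \<in> V \<Longrightarrow> 0 \<le> y z" "\<And>z. z \<in> V \<Longrightarrow> y z \<le> 1"
    and w: "w \<in> V" "y w = 1"
    and uv: "u \<in> V" "v \<in> N u" "y u \<le> y v"
    and lap: "\<And>z. z \<in> V \<Longrightarrow> (\<Sum>j\<in>N z. y z - y j) \<le> \<delta> * y z - r z"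
    and r: "\<And>z. z \<in> V \<Longrightarrow> 0 \<le> r z" "y v \<le> r u" "y u \<le> r v"
  shows "(real k)\<^sup>2 / ((real (card V) - real d - 1) * (real (card V) - real d + 2 * real k - 2)
    + real (card V) * (real k)\<^sup>2) < \<delta>"
proof (rule ccontr)
  define n where "n = real (card V)"
  define A where "A = n - real d - 1"
  define L where "L = n - real d + 2 * real k - 2"
  define D where "D = 1 - y u"
  define f where "f z = max 0 (y z - y u)" for z
  have v: "v \<in> V" "v \<noteq> u" using uv N_subset N_irrefl by auto
  have A0: "0 \<le> A" using d_less_card unfolding A_def n_def by linarith
  \<comment> \<open>\<open>A\<close> takes integer values; the value 0, the complete graph, is
    treated separately at the end.\<close>
  have A1: "A = 0 \<or> 1 \<le> A"
    using d_less_card unfolding A_def n_def by (cases "card V = d + 1") auto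
  have k1: "1 \<le> real k" using k_pos by simp
  have n2: "real k + 1 \<le> n" using k_less_card unfolding n_def by linarith
  have L1: "1 \<le> L" using A0 k1 unfolding A_def L_def by linarith
  have kk: "2 * real k - 1 \<le> (real k)\<^sup>2"
    using zero_le_power2[of "real k - 1"] by (simp add: power2_diff)
  have den: "0 < A * L + n * (real k)\<^sup>2"
    using A0 L1 k1 n2 by (intro add_nonneg_pos mult_nonneg_nonneg mult_pos_pos) auto
  assume "\<not> ?thesis"
  then have "\<delta> \<le> (real k)\<^sup>2 / (A * L + n * (real k)\<^sup>2)"
    unfolding A_def L_def n_def by simp
  then have small: "\<delta> * (A * L + n * (real k)\<^sup>2) \<le> (real k)\<^sup>2"
    using den by (simp add: field_simps)

  \<comment> \<open>The Laplacian sums to 0, so the total of \<open>r\<close>, and with it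
    \<open>y u + y v\<close>, is at most \<open>\<delta>\<close> times the total of
    \<open>y\<close>.\<close>
  have "0 = (\<Sum>z\<in>V. \<Sum>j\<in>N z. y z - y j)"
    using laplacian_sum by simp
  also have "\<dots> \<le> (\<Sum>z\<in>V. \<delta> * y z - r z)"
    using lap by (rule sum_mono)
  also have "\<dots> = \<delta> * (\<Sum>z\<in>V. y z) - (\<Sum>z\<in>V. r z)"
    by (simp add: sum_subtractf sum_distrib_left)
  finally have "(\<Sum>z\<in>V. r z) \<le> \<delta> * (\<Sum>z\<in>V. y z)" by simp
  moreover have "r u + r v \<le> (\<Sum>z\<in>V. r z)"
    using sum_mono2[of V "{u, v}" r] finite_V r(1) uv v by auto
  ultimately have uv_le: "y u + y v \<le> \<delta> * (\<Sum>z\<in>V. y z)" using r by linarith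
  have sum_y: "1 \<le> (\<Sum>z\<in>V. y z)"
    using member_le_sum[of w V y] finite_V y(1) w by auto
  have \<delta>0: "0 \<le> \<delta>"
    using uv_le y(1) uv v sum_y by (smt (verit) mult_neg_pos)
  have \<delta>n: "\<delta> * n \<le> 1"
  proof -
    have "\<delta> * n * (real k)\<^sup>2 \<le> 1 * (real k)\<^sup>2"
      using small mult_nonneg_nonneg[OF \<delta>0 mult_nonneg_nonneg[of A L]] A0 L1
      by (simp add: algebra_simps)
    then show ?thesis using k1 by (simp add: mult_le_cancel_right)
  qed
  have sum_y_le: "(\<Sum>z\<in>V. y z) \<le> n - 1 + y u"
  proof -
    have "(\<Sum>z\<in>V. y z) = y u + (\<Sum>z\<in>V - {u}. y z)"
      using finite_V uv by (simp add: sum.remove)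
    also have "(\<Sum>z\<in>V - {u}. y z) \<le> real (card (V - {u})) * 1"
      using y(2) by (intro sum_bounded_above) auto
    also have "real (card (V - {u})) = n - 1"
      using finite_V uv n2 unfolding n_def by (simp add: of_nat_diff)
    finally show ?thesis by simp
  qed
  \<comment> \<open>With \<open>\<delta> * n \<le> 1\<close> this yields first
    \<open>y u < 1\<close>, then \<open>2 * y u \<le> 1\<close>, and so
    \<open>\<delta> \<le> 1 \<le> 2 * D\<close>, as the drop bound requires.\<close>
  have yu: "2 * y u \<le> \<delta> * (n - 1 + y u)"
    using uv_le uv(3) mult_left_mono[OF sum_y_le \<delta>0] by linarith
  have yu1: "y u < 1"
  proof (rule ccontr)
    assume "\<not> y u < 1"
    then have "y u = 1" using y(2)[OF uv(1)] by simp
    then show False using yu \<delta>n by simp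
  qed
  have "\<delta> * (n - 1 + y u) \<le> \<delta> * n"
    using \<delta>0 yu1 by (intro mult_left_mono) auto
  then have "2 * y u \<le> 1" using yu \<delta>n by (meson order_trans)
  then have D_half: "1 \<le> 2 * D" unfolding D_def by simp
  have "\<delta> * 1 \<le> \<delta> * n" using \<delta>0 n2 k1 by (intro mult_left_mono) auto
  then have \<delta>1: "\<delta> \<le> 1" using \<delta>n by simp

  have source: "(\<Sum>i\<in>V. f i * (\<Sum>j\<in>N i. f i - f j)) \<le> \<delta> * (\<Sum>i\<in>V. f i)"
    unfolding sum_distrib_left[of \<delta>]
  proof (rule sum_mono)
    fix i assume i: "i \<in> V"
    show "f i * (\<Sum>j\<in>N i. f i - f j) \<le> \<delta> * f i"
    proof (cases "f i = 0")
      case False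
      \<comment> \<open>Above the level \<open>y u\<close>, truncation can only lower the Laplacian:
        \<open>f i = y i - y u\<close>, while \<open>f j \<ge> y j - y u\<close>.\<close>
      then have "y u < y i" unfolding f_def by auto
      then have "(\<Sum>j\<in>N i. f i - f j) \<le> (\<Sum>j\<in>N i. y i - y j)"
        unfolding f_def by (intro sum_mono) auto
      also have "\<dots> \<le> \<delta> * y i" using lap[OF i] r(1)[OF i] by simp
      also have "\<dots> \<le> \<delta> * 1" using y(2)[OF i] \<delta>0 by (intro mult_left_mono) auto
      finally have "(\<Sum>j\<in>N i. f i - f j) \<le> \<delta>" by simp
      moreover have "0 \<le> f i" unfolding f_def by simp
      ultimately show ?thesis by (metis mult.commute mult_left_mono)
    qed simp
  qed
  have drop: "(real k)\<^sup>2 * (D - \<delta> / 2)\<^sup>2 \<le> L * (\<delta> * A * D + real d * \<delta>\<^sup>2 / 4)"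
    unfolding L_def A_def n_def
  proof (rule potential_drop_bound[OF uv(1) _ w(1) _ _ _ \<delta>0 _ _ source])
    show "f u = 0" "f w = D" "0 \<le> f z" "\<delta> \<le> 2 * D" "0 < D" for z
      using w yu1 \<delta>1 D_half unfolding f_def D_def by auto
    show "f z \<le> D" if "z \<in> V" for z
      using y(2)[OF that] yu1 unfolding f_def D_def by auto
  qed

  have \<delta>_pos: "0 < \<delta>"
  proof (rule ccontr)
    assume "\<not> 0 < \<delta>"
    then have "\<delta> = 0" using \<delta>0 by simp
    then have "(real k)\<^sup>2 * D\<^sup>2 \<le> 0" using drop by simp
    moreover have "0 < (real k)\<^sup>2 * D\<^sup>2" using k1 D_half by simp
    ultimately show False by simp
  qed
  define P where "P = D - \<delta> / 2"
  \<comment> \<open>What remains of the coefficient \<open>n\<close> in \<open>small\<close> after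
    the loss of \<open>(n + 1) / 2\<close> in the lower bound for \<open>P\<close>.\<close>
  define M where "M = (n - 1) / 2"
  have M0: "0 < M" using n2 k1 unfolding M_def by simp
  have dA: "real d = 2 * M - A" unfolding A_def M_def by (simp add: field_simps)
  have "2 * y u < \<delta> * n"
    using yu mult_strict_left_mono[of "n - 1 + y u" n \<delta>] \<delta>_pos yu1 by linarith
  then have "1 - \<delta> * n / 2 - \<delta> / 2 < P" unfolding P_def D_def by simp
  then have "(real k)\<^sup>2 * (1 - \<delta> * n / 2 - \<delta> / 2) < (real k)\<^sup>2 * P"
    using k1 by (intro mult_strict_left_mono) auto
  then have lower: "\<delta> * (A * L + (real k)\<^sup>2 * M) < (real k)\<^sup>2 * P"
    using small unfolding M_def by (simp add: field_simps)
  moreover have AL: "0 \<le> A * L" using A0 L1 by simp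
  ultimately have "0 < (real k)\<^sup>2 * P"
    using mult_nonneg_nonneg[OF \<delta>0, of "A * L + (real k)\<^sup>2 * M"] M0 by simp
  then have P_pos: "0 < P" using k1 by (simp add: zero_less_mult_iff)
  \<comment> \<open>The inequality \<open>lower\<close> is used twice, multiplied by
    \<open>\<delta> * M\<close> and then by \<open>P\<close>, so that the drop bound leaves a common
    factor \<open>\<delta>\<^sup>2\<close> to cancel.\<close>
  have "\<delta> * M * (\<delta> * (A * L + (real k)\<^sup>2 * M)) < \<delta> * M * ((real k)\<^sup>2 * P)"
    using lower \<delta>_pos M0 by (intro mult_strict_left_mono) auto
  also have "\<dots> = P * (\<delta> * (real k)\<^sup>2 * M)" by simp
  also have "\<dots> \<le> P * ((real k)\<^sup>2 * P - \<delta> * A * L)"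
    using lower P_pos by (intro mult_left_mono) (auto simp: algebra_simps)
  also have "\<dots> = (real k)\<^sup>2 * P\<^sup>2 - L * \<delta> * A * P" by (simp add: algebra_simps power2_eq_square)
  also have "\<dots> \<le> L * (\<delta> * A * D + real d * \<delta>\<^sup>2 / 4) - L * \<delta> * A * P"
    using drop unfolding P_def by simp
  also have "\<dots> = \<delta>\<^sup>2 * (L * (2 * M + A) / 4)"
    unfolding P_def dA by (simp add: field_simps power2_eq_square)
  finally have "\<delta>\<^sup>2 * (M * (A * L + (real k)\<^sup>2 * M)) < \<delta>\<^sup>2 * (L * (2 * M + A) / 4)"
    by (simp add: algebra_simps power2_eq_square)
  then have "M * (A * L + (real k)\<^sup>2 * M) < L * (2 * M + A) / 4"
    by (rule mult_left_less_imp_less) simp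
  then have final: "4 * M * (A * L) + 4 * (real k)\<^sup>2 * M\<^sup>2 < L * (2 * M + A)"
    by (simp add: algebra_simps power2_eq_square)
  show False
  \<comment> \<open>If \<open>A = 0\<close>, there remains
    \<open>(real k)\<^sup>2 < 2 * real k - 1\<close>. Otherwise
    \<open>2 * M + A \<le> 4 * M * A\<close>, since \<open>A\<close> and \<open>2 * M\<close> are at
    least 1.\<close>
  proof (cases "A = 0")
    case True
    then have L: "L = 2 * real k - 1" unfolding A_def L_def by simp
    have "4 * (real k)\<^sup>2 * M\<^sup>2 < L * (2 * M)" using final True by simp
    then have "2 * M * (2 * M * (real k)\<^sup>2) < 2 * M * L" by (simp add: power2_eq_square algebra_simps)
    then have "2 * M * (real k)\<^sup>2 < L" using M0 by simp
    moreover have "1 * (real k)\<^sup>2 \<le> 2 * M * (real k)\<^sup>2"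
      using n2 k1 unfolding M_def by (intro mult_right_mono) auto
    ultimately show False using L kk by simp
  next
    case False
    then have "1 \<le> A" using A1 by simp
    then have "2 * M * 1 \<le> 2 * M * A" using M0 by (intro mult_left_mono) auto
    moreover have "1 * A \<le> 2 * M * A"
      using n2 k1 A0 unfolding M_def by (intro mult_right_mono) auto
    ultimately have "L * (2 * M + A) \<le> L * (4 * M * A)"
      using L1 by (intro mult_left_mono) auto
    moreover have "L * (4 * M * A) = 4 * M * (A * L)" by simp
    moreover have "0 \<le> 4 * (real k)\<^sup>2 * M\<^sup>2" by simp
    ultimately show False using final by linarith
  qed
qed

end

section \<open>Eigenvectors of the adjacency matrix\<close>

lemma mult_mat_vec_index_sum:
  assumes "A \<in> carrier_mat n n" "v \<in> carrier_vec n" "i < n"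
  shows "(A *\<^sub>v v) $ i = (\<Sum>j<n. A $$ (i, j) * v $ j)"
  using assms by (simp add: scalar_prod_def lessThan_atLeast0)

text \<open>A complex eigenvalue exists and is real, because the Hermitian form of a real symmetric
  matrix takes real values; it is then a root of the real characteristic polynomial. Thus
  \<open>lambda1\<close> is a maximum over a nonempty set.\<close>

lemma symmetric_real_spectrum_nonempty:
  fixes A :: "real mat"
  assumes A: "A \<in> carrier_mat n n" and "0 < n"
    and sym: "\<And>i j. i < n \<Longrightarrow> j < n \<Longrightarrow> A $$ (i, j) = A $$ (j, i)"
  shows "spectrum A \<noteq> {}"
proof -
  define C where "C = map_mat complex_of_real A"
  have C: "C \<in> carrier_mat n n" using A unfolding C_def by simp
  obtain c where c: "eigenvalue C c"
    using spectrum_non_empty[OF C \<open>0 < n\<close>] unfolding spectrum_def by auto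
  then obtain v where v: "v \<in> carrier_vec n" "v \<noteq> 0\<^sub>v n" "C *\<^sub>v v = c \<cdot>\<^sub>v v"
    using C unfolding eigenvalue_def eigenvector_def by auto
  have row: "(\<Sum>j<n. complex_of_real (A $$ (i, j)) * v $ j) = c * v $ i" if "i < n" for i
    using mult_mat_vec_index_sum[OF C v(1) that] v that A unfolding C_def by simp
  define S where "S = (\<Sum>i<n. \<Sum>j<n. cnj (v $ i) * (complex_of_real (A $$ (i, j)) * v $ j))"
  define q where "q = (\<Sum>i<n. (cmod (v $ i))\<^sup>2)"
  have "S = (\<Sum>i<n. cnj (v $ i) * (c * v $ i))"
    unfolding S_def by (simp add: row flip: sum_distrib_left)
  also have "\<dots> = c * of_real q"
    unfolding q_def of_real_sum sum_distrib_left
    by (intro sum.cong) (simp_all only: complex_norm_square mult_ac)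
  finally have S: "S = c * of_real q" .
  have "cnj S = (\<Sum>i<n. \<Sum>j<n. v $ i * (complex_of_real (A $$ (i, j)) * cnj (v $ j)))"
    unfolding S_def by simp
  also have "\<dots> = (\<Sum>j<n. \<Sum>i<n. v $ i * (complex_of_real (A $$ (i, j)) * cnj (v $ j)))"
    by (rule sum.swap)
  also have "\<dots> = S"
    unfolding S_def by (intro sum.cong) (auto simp: sym mult_ac)
  finally have "cnj S = S" .
  moreover have "q \<noteq> 0"
  proof
    assume "q = 0"
    then have "v $ i = 0" if "i < n" for i
      using that unfolding q_def by (subst (asm) sum_nonneg_eq_0_iff) auto
    then show False using v by (auto simp: vec_eq_iff)
  qed
  ultimately have "cnj c = c" using S by simp
  then obtain r where r: "c = complex_of_real r"
    using Reals_cnj_iff by (auto elim: Reals_cases)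
  have "poly (char_poly C) c = 0"
    using c eigenvalue_root_char_poly[OF C] by blast
  also have "char_poly C = map_poly complex_of_real (char_poly A)"
    unfolding C_def by (rule of_real_hom.char_poly_hom[OF A])
  finally have "poly (char_poly A) r = 0"
    unfolding r of_real_hom.poly_map_poly by simp
  then show ?thesis using spectrum_root_char_poly[OF A] by auto
qed

text \<open>Take absolute values of an eigenvector and extend by zero. As the matrix entries are
  nonnegative, the triangle inequality turns the eigenvalue equation into an inequality.\<close>

lemma lambda1_subeigenvector:
  fixes H :: "'a pair_pre_digraph"
  assumes "pair_graph H" "pverts H \<noteq> {}"
  obtains y :: "'a \<Rightarrow> real" where "\<And>z. 0 \<le> y z" "\<exists>z\<in>pverts H. y z \<noteq> 0"
    "\<And>z. z \<notin> pverts H \<Longrightarrow> y z = 0"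
    "\<And>z. z \<in> pverts H \<Longrightarrow> lambda1 H * y z \<le> (\<Sum>j | (z, j) \<in> parcs H. y j)"
proof -
  interpret pair_graph H by fact
  define vs where "vs = vertex_enum H"
  define m where "m = length vs"
  define A where "A = adjacency_matrix H"
  have "\<exists>vs. distinct vs \<and> set vs = pverts H"
    using finite_distinct_list[OF pair_finite_verts] by auto
  then have vs: "distinct vs" "set vs = pverts H"
    unfolding vs_def vertex_enum_def by (metis (mono_tags, lifting) someI_ex)+
  have Aeq: "A = mat m m (\<lambda>(i, j). if (vs ! i, vs ! j) \<in> parcs H then 1 else 0)"
    unfolding A_def adjacency_matrix_def vs_def m_def Let_def ..
  have A: "A \<in> carrier_mat m m" unfolding Aeq by simp
  have "0 < m" using vs assms(2) unfolding m_def by auto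
  have "A $$ (i, j) = A $$ (j, i)" if "i < m" "j < m" for i j
    using that arcs_symmetric[of "vs ! i" "vs ! j"] arcs_symmetric[of "vs ! j" "vs ! i"]
    by (auto simp: Aeq)
  then have "spectrum A \<noteq> {}"
    by (rule symmetric_real_spectrum_nonempty[OF A \<open>0 < m\<close>])
  then have "lambda1 H \<in> spectrum A"
    unfolding lambda1_def A_def[symmetric] using card_finite_spectrum(1)[OF A] by (intro Max_in)
  then obtain v where v: "v \<in> carrier_vec m" "v \<noteq> 0\<^sub>v m" "A *\<^sub>v v = lambda1 H \<cdot>\<^sub>v v"
    using A unfolding spectrum_def eigenvalue_def eigenvector_def by auto
  have bij: "bij_betw ((!) vs) {..<m} (pverts H)"
    using bij_betw_nth[OF vs(1) refl vs(2)[symmetric]] unfolding m_def .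
  define pos where "pos = the_inv_into {..<m} ((!) vs)"
  have pos: "pos (vs ! i) = i" if "i < m" for i
    unfolding pos_def using bij that by (intro the_inv_into_f_f) (auto simp: bij_betw_def)
  define y where "y z = (if z \<in> pverts H then \<bar>v $ pos z\<bar> else 0)" for z
  have mem: "vs ! i \<in> pverts H" if "i < m" for i
    using nth_mem[of i vs] that vs(2) unfolding m_def by simp
  have ex: "\<exists>i<m. z = vs ! i" if "z \<in> pverts H" for z
    using that vs(2) unfolding m_def by (metis in_set_conv_nth)
  have y_nth: "y (vs ! i) = \<bar>v $ i\<bar>" if "i < m" for i
    using pos[OF that] mem[OF that] unfolding y_def by simp
  show thesis
  proof
    show "0 \<le> y z" for z unfolding y_def by simp
    show "y z = 0" if "z \<notin> pverts H" for z using that unfolding y_def by simp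
    have "\<exists>i<m. v $ i \<noteq> 0"
      using v(1,2) by (metis carrier_vecD eq_vecI index_zero_vec)
    then obtain i where "i < m" "v $ i \<noteq> 0" by blast
    then show "\<exists>z\<in>pverts H. y z \<noteq> 0"
      using y_nth mem by (metis abs_eq_0)
  next
    fix z assume "z \<in> pverts H"
    then obtain i where i: "i < m" "z = vs ! i" using ex by auto
    have "lambda1 H * \<bar>v $ i\<bar> \<le> \<bar>lambda1 H * v $ i\<bar>"
      by (simp add: abs_mult mult_right_mono)
    also have "lambda1 H * v $ i = (\<Sum>j<m. A $$ (i, j) * v $ j)"
      using mult_mat_vec_index_sum[OF A v(1) i(1)] v(1,3) i(1) by simp
    also have "\<bar>\<dots>\<bar> \<le> (\<Sum>j<m. \<bar>A $$ (i, j) * v $ j\<bar>)" by (rule sum_abs)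
    also have "\<dots> = (\<Sum>j<m. if (z, vs ! j) \<in> parcs H then y (vs ! j) else 0)"
      using i by (intro sum.cong) (auto simp: Aeq y_nth)
    also have "\<dots> = (\<Sum>b\<in>pverts H. if (z, b) \<in> parcs H then y b else 0)"
      by (rule sum.reindex_bij_betw[OF bij])
    also have "\<dots> = (\<Sum>j\<in>pverts H \<inter> {j. (z, j) \<in> parcs H}. y j)"
      using pair_finite_verts by (simp add: sum.inter_restrict)
    also have "pverts H \<inter> {j. (z, j) \<in> parcs H} = {j. (z, j) \<in> parcs H}"
      using in_arcsD2 by auto
    finally show "lambda1 H * y z \<le> (\<Sum>j | (z, j) \<in> parcs H. y j)"
      using i y_nth by simp
  qed
qed

section \<open>From digraphs to neighbourhoods, and the final assembly\<close>

text \<open>Deleting the fewer than \<open>k\<close> other vertices leaves a connected graph on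
  \<open>X \<union> Y\<close>. Without an arc from \<open>X\<close> to \<open>Y\<close>, a walk
  starting in \<open>X\<close> would never leave \<open>X\<close>.\<close>

lemma k_connected_edge_between:
  fixes G :: "'a pair_pre_digraph"
  assumes "pair_graph G" "k_connected_graph k G"
    and X: "X \<subseteq> pverts G" "X \<noteq> {}" and Y: "Y \<subseteq> pverts G" "Y \<noteq> {}"
    and "X \<inter> Y = {}" "card (pverts G - X - Y) < k"
  shows "\<exists>a\<in>X. \<exists>b\<in>Y. (a, b) \<in> parcs G"
proof (rule ccontr)
  assume none: "\<not> ?thesis"
  interpret pair_graph G by fact
  have "pverts G - (pverts G - X - Y) = X \<union> Y" using X Y by auto
  moreover have "pverts G - X - Y \<subseteq> pverts G" by auto
  ultimately have "Digraph_Component.connected (induce_subgraph (with_proj G) (X \<union> Y))"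
    using assms(2,8) unfolding k_connected_graph_def by metis
  moreover obtain a b where ab: "a \<in> X" "b \<in> Y" using X Y by auto
  ultimately have "(a, b) \<in> rtrancl_on (X \<union> Y)
      (arcs_ends (with_proj (mk_symmetric (induce_subgraph (with_proj G) (X \<union> Y)))))"
    unfolding Digraph_Component.connected_def strongly_connected_def reachable_def
    by (auto simp: mk_symmetric_def)
  then have "b \<in> X"
  proof (induction rule: rtrancl_on_induct)
    case base
    show ?case by (rule ab)
  next
    case (step p q)
    then have "(p, q) \<in> parcs G" "q \<in> X \<union> Y"
      by (auto simp: mk_symmetric_def intro: arcs_symmetric)
    then show ?case using none step by auto
  qed
  then show False using ab assms(7) by auto
qed

theorem theorem1p8:
  fixes G H :: "'a pair_pre_digraph" and k \<Delta> n :: nat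
  assumes "k > 0"
    and "pair_graph G"
    and "card (pverts G) = n"
    and "k_connected_graph k G"
    and "regular_graph \<Delta> G"
    and "pair_graph H"
    and "pverts H \<noteq> {}"
    and "subgraph (with_proj H) (with_proj G)"
    and "H \<noteq> G"
  shows "real \<Delta> - lambda1 H >
    (real k)\<^sup>2 /
      ((real n - real \<Delta> - 1) * (real n - real \<Delta> + 2 * real k - 2) + real n * (real k)\<^sup>2)"
proof -
  interpret G: pair_graph G by fact
  interpret H: pair_graph H by fact
  have sub: "pverts H \<subseteq> pverts G" "parcs H \<subseteq> parcs G"
    using assms(8) unfolding subgraph_def by auto
  define N where "N z = {j. (z, j) \<in> parcs G}" for z
  define NH where "NH z = {j. (z, j) \<in> parcs H}" for z
  have card_N: "card (N z) = \<Delta>" if "z \<in> pverts G" for z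
  proof -
    have "out_arcs (with_proj G) z = Pair z ` N z"
      unfolding out_arcs_def N_def by auto
    then have "card (out_arcs (with_proj G) z) = card (N z)"
      by (simp add: card_image inj_on_def)
    then show ?thesis
      using assms(5) that unfolding regular_graph_def out_degree_def by simp
  qed
  interpret regular_k_connected "pverts G" N k \<Delta>
  proof
    show "finite (pverts G)" by (rule G.pair_finite_verts)
    show "N a \<subseteq> pverts G" for a using G.in_arcsD2 unfolding N_def by blast
    show "a \<in> N b" if "b \<in> N a" for a b using that G.arcs_symmetric unfolding N_def by blast
    show "a \<notin> N a" for a using G.no_loops' unfolding N_def by blast
    show "k < card (pverts G)" using assms(4) unfolding k_connected_graph_def by blast
    show "\<exists>a\<in>X. \<exists>b\<in>Y. b \<in> N a"
      if "X \<subseteq> pverts G" "Y \<subseteq> pverts G" "X \<noteq> {}" "Y \<noteq> {}" "X \<inter> Y = {}"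
        "card (pverts G - X - Y) < k" for X Y
      using k_connected_edge_between[OF assms(2,4) that(1,3,2,4,5,6)] unfolding N_def by blast
  qed (use card_N \<open>k > 0\<close> in auto)

  obtain x where x: "\<And>z. 0 \<le> x z" "\<exists>z\<in>pverts H. x z \<noteq> 0" "\<And>z. z \<notin> pverts H \<Longrightarrow> x z = 0"
    "\<And>z. z \<in> pverts H \<Longrightarrow> lambda1 H * x z \<le> (\<Sum>j | (z, j) \<in> parcs H. x j)"
    using lambda1_subeigenvector[OF assms(6,7)] by blast
  define M where "M = Max (x ` pverts G)"
  have ne: "pverts G \<noteq> {}" using sub assms(7) by blast
  then have "M \<in> x ` pverts G"
    unfolding M_def using finite_V by (intro Max_in) auto
  then obtain w where w: "w \<in> pverts G" "x w = M" by blast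
  have x_le: "x z \<le> M" if "z \<in> pverts G" for z
    unfolding M_def using that finite_V by simp
  obtain z0 where "z0 \<in> pverts H" "x z0 \<noteq> 0" using x(2) by blast
  then have "0 < x z0" "x z0 \<le> M" using x(1)[of z0] x_le sub by auto
  then have M: "0 < M" by linarith
  define y where "y z = x z / M" for z
  have y: "0 \<le> y z" "z \<in> pverts G \<Longrightarrow> y z \<le> 1" for z
    using x(1)[of z] x_le[of z] M unfolding y_def by auto
  have yw: "y w = 1" using w M unfolding y_def by simp
  have sub_eigen: "lambda1 H * y z \<le> (\<Sum>j\<in>NH z. y j)" for z
  proof (cases "z \<in> pverts H")
    case True
    have "lambda1 H * x z / M \<le> (\<Sum>j\<in>NH z. x j) / M"
      using x(4)[OF True] M unfolding NH_def by (intro divide_right_mono) auto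
    then show ?thesis unfolding y_def by (simp add: sum_divide_distrib)
  next
    case False
    then show ?thesis using x(3) y(1) unfolding y_def by (simp add: sum_nonneg)
  qed
  have NH_sub: "NH z \<subseteq> N z" for z using sub unfolding N_def NH_def by blast
  \<comment> \<open>The mass seen from \<open>z\<close> along arcs absent from \<open>H\<close>. For
    \<open>z\<close> outside \<open>H\<close> these are all its arcs, so missing vertices are
    covered as well.\<close>
  define r where "r z = (\<Sum>j\<in>N z - NH z. y j)" for z
  have lap: "(\<Sum>j\<in>N z. y z - y j) \<le> (real \<Delta> - lambda1 H) * y z - r z" if "z \<in> pverts G" for z
  proof -
    have "(\<Sum>j\<in>N z. y j) = r z + (\<Sum>j\<in>NH z. y j)"
      unfolding r_def using NH_sub finite_N[OF that] by (rule sum.subset_diff)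
    then show ?thesis
      using sub_eigen[of z] card_N[OF that] by (simp add: sum_subtractf algebra_simps)
  qed
  have r0: "0 \<le> r z" for z unfolding r_def using y(1) by (intro sum_nonneg)

  \<comment> \<open>A missing vertex entails missing arcs, because degrees in \<open>G\<close> are
    positive.\<close>
  have "\<exists>u v. (u, v) \<in> parcs G - parcs H"
  proof (rule ccontr)
    assume "\<not> ?thesis"
    then have arcs: "parcs H = parcs G" using sub by auto
    then have "pverts H \<noteq> pverts G" using \<open>H \<noteq> G\<close> by (metis pair_pre_digraph.equality unit.exhaust)
    then obtain z where z: "z \<in> pverts G" "z \<notin> pverts H" using sub by blast
    have "N z \<noteq> {}" using card_N[OF z(1)] k_le_d k_pos by auto
    then show False using z arcs H.in_arcsD1 unfolding N_def by blast
  qed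
  then obtain a b where ab: "(a, b) \<in> parcs G" "(a, b) \<notin> parcs H" by blast
  then have ba: "(b, a) \<in> parcs G" "(b, a) \<notin> parcs H"
    using G.arcs_symmetric H.arcs_symmetric by blast+
  \<comment> \<open>The missing edge is oriented so that \<open>u\<close> is its lower end, towards
    which the drop from \<open>w\<close> is measured.\<close>
  obtain u v where uv: "(u, v) \<in> parcs G" "(u, v) \<notin> parcs H"
    "(v, u) \<in> parcs G" "(v, u) \<notin> parcs H" "y u \<le> y v"
    using ab ba by (metis linear)
  have r_ge: "y q \<le> r p" if "(p, q) \<in> parcs G" "(p, q) \<notin> parcs H" for p q
    unfolding r_def using that finite_N[OF G.in_arcsD1[OF that(1)]] y(1)
    by (intro member_le_sum) (auto simp: N_def NH_def)
  have "(real k)\<^sup>2 / ((real (card (pverts G)) - real \<Delta> - 1) * (real (card (pverts G)) - real \<Delta> + 2 * real k - 2)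
    + real (card (pverts G)) * (real k)\<^sup>2) < real \<Delta> - lambda1 H"
    using y w(1) yw G.in_arcsD1[OF uv(1)] uv r0 r_ge lap
    by (intro eigenvalue_gap[where y = y and w = w and u = u and v = v and r = r]) (auto simp: N_def)
  then show ?thesis using assms(3) by simp
qed

end
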